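(* Let $\mathfrak{g}=\mathfrak{a}\rtimes\mathfrak{s}$ be a finite-dimensional complex perfect Lie algebra (i.e. $[\mathfrak{g},\mathfrak{g}]=\mathfrak{g}$), where $\mathfrak{s}$ is a semisimple Lie algebra and the solvable radical $\mathfrak{a}$ of $\mathfrak{g}$ is abelian. Assume that $\mathfrak{a}$, as an $\mathfrak{s}$-module, decomposes as a direct sum of pairwise non-isomorphic irreducible $\mathfrak{s}$-modules. Then any commutative post-Lie algebra structure on $\mathfrak{g}$ is trivial, i.e., $x\cdot y=0$ for all $x,y\in\mathfrak{g}$.
   Context: A commutative post-Lie algebra structure on a Lie algebra $\mathfrak{g}$ is a bilinear product $\mathfrak{g}\times\mathfrak{g}\to\mathfrak{g}$, $(x,y)\mapsto x\cdot y$, such that for all $x,y,z\in\mathfrak{g}$: $x\cdot y=y\cdot x$; $[x,y]\cdot z=x\cdot(y\cdot z)-y\cdot(x\cdot z)$; $x\cdot[y,z]=[x\cdot y,z]+[y,x\cdot z]$. The $\mathfrak{s}$-module structure on $\mathfrak{a}$ is given by the bracket of $\mathfrak{g}$. *)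

theory Defs
  imports Complex_Main
begin

text \<open>The ambient Lie algebra is the whole type \<open>'a\<close>; subalgebras, ideals and modules inside it are
  sets of type \<open>'a set\<close>.\<close>

definition bilinear_on_space :: "('k::field \<Rightarrow> 'a::ab_group_add \<Rightarrow> 'a) \<Rightarrow> ('a \<Rightarrow> 'a \<Rightarrow> 'a) \<Rightarrow> bool" where
  "bilinear_on_space scale f \<longleftrightarrow>
     (\<forall>y. Vector_Spaces.linear scale scale (\<lambda>x. f x y)) \<and>
     (\<forall>x. Vector_Spaces.linear scale scale (\<lambda>y. f x y))"

locale lie_algebra = vector_space scale
  for scale :: "'k::field \<Rightarrow> 'a::ab_group_add \<Rightarrow> 'a" +
  fixes br :: "'a \<Rightarrow> 'a \<Rightarrow> 'a"
  assumes bilinear_br: "bilinear_on_space scale br"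
    and alternating: "br x x = 0"
    and jacobi: "br x (br y z) + br y (br z x) + br z (br x y) = 0"
begin

definition bracket_space :: "'a set \<Rightarrow> 'a set \<Rightarrow> 'a set" where
  "bracket_space U V = span {br x y | x y. x \<in> U \<and> y \<in> V}"

definition perfect :: bool where
  "perfect \<longleftrightarrow> bracket_space UNIV UNIV = UNIV"

definition abelian :: "'a set \<Rightarrow> bool" where
  "abelian L \<longleftrightarrow> (\<forall>x\<in>L. \<forall>y\<in>L. br x y = 0)"

definition subalgebra :: "'a set \<Rightarrow> bool" where
  "subalgebra L \<longleftrightarrow> subspace L \<and> (\<forall>x\<in>L. \<forall>y\<in>L. br x y \<in> L)"

definition ideal_of :: "'a set \<Rightarrow> 'a set \<Rightarrow> bool" where
  "ideal_of I L \<longleftrightarrow> subspace I \<and> I \<subseteq> L \<and> (\<forall>x\<in>L. \<forall>y\<in>I. br x y \<in> I)"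

primrec derived_series :: "'a set \<Rightarrow> nat \<Rightarrow> 'a set" where
  "derived_series L 0 = L"
| "derived_series L (Suc n) = bracket_space (derived_series L n) (derived_series L n)"

definition solvable :: "'a set \<Rightarrow> bool" where
  "solvable L \<longleftrightarrow> (\<exists>n. derived_series L n = {0})"

definition solvable_radical_of :: "'a set \<Rightarrow> 'a set \<Rightarrow> bool" where
  "solvable_radical_of R L \<longleftrightarrow>
     ideal_of R L \<and> solvable R \<and> (\<forall>I. ideal_of I L \<and> solvable I \<longrightarrow> I \<subseteq> R)"

definition semisimple :: "'a set \<Rightarrow> bool" where
  "semisimple L \<longleftrightarrow> subalgebra L \<and> solvable_radical_of {0} L"

text \<open>The inner semidirect product of an ideal \<open>A\<close> and a subalgebra \<open>S\<close>, equal to the whole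
  Lie algebra.\<close>

definition semidirect_product :: "'a set \<Rightarrow> 'a set \<Rightarrow> bool" where
  "semidirect_product A S \<longleftrightarrow>
     ideal_of A UNIV \<and> subalgebra S \<and> A \<inter> S = {0} \<and> {a + s | a s. a \<in> A \<and> s \<in> S} = UNIV"

text \<open>An \<open>S\<close>-module is here a subspace of the ambient Lie algebra that is stable under the bracket
  with \<open>S\<close>, the action of \<open>x \<in> S\<close> being \<open>br x\<close>.\<close>

definition lie_module :: "'a set \<Rightarrow> 'a set \<Rightarrow> bool" where
  "lie_module S V \<longleftrightarrow> subspace V \<and> (\<forall>x\<in>S. \<forall>v\<in>V. br x v \<in> V)"

definition irreducible_module :: "'a set \<Rightarrow> 'a set \<Rightarrow> bool" where
  "irreducible_module S V \<longleftrightarrow>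
     lie_module S V \<and> V \<noteq> {0} \<and> (\<forall>W. lie_module S W \<and> W \<subseteq> V \<longrightarrow> W = {0} \<or> W = V)"

definition module_iso :: "'a set \<Rightarrow> 'a set \<Rightarrow> 'a set \<Rightarrow> ('a \<Rightarrow> 'a) \<Rightarrow> bool" where
  "module_iso S V W f \<longleftrightarrow>
     bij_betw f V W \<and>
     (\<forall>u\<in>V. \<forall>v\<in>V. f (u + v) = f u + f v) \<and>
     (\<forall>c. \<forall>v\<in>V. f (scale c v) = scale c (f v)) \<and>
     (\<forall>x\<in>S. \<forall>v\<in>V. f (br x v) = br x (f v))"

definition isomorphic_modules :: "'a set \<Rightarrow> 'a set \<Rightarrow> 'a set \<Rightarrow> bool" where
  "isomorphic_modules S V W \<longleftrightarrow> (\<exists>f. module_iso S V W f)"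

definition direct_sum_of :: "'a set \<Rightarrow> nat \<Rightarrow> (nat \<Rightarrow> 'a set) \<Rightarrow> bool" where
  "direct_sum_of A n V \<longleftrightarrow>
     A = {\<Sum>i<n. v i | v. \<forall>i<n. v i \<in> V i} \<and>
     (\<forall>v. (\<forall>i<n. v i \<in> V i) \<and> (\<Sum>i<n. v i) = 0 \<longrightarrow> (\<forall>i<n. v i = 0))"

definition commutative_post_lie :: "('a \<Rightarrow> 'a \<Rightarrow> 'a) \<Rightarrow> bool" where
  "commutative_post_lie p \<longleftrightarrow>
     bilinear_on_space scale p \<and>
     (\<forall>x y. p x y = p y x) \<and>
     (\<forall>x y z. p (br x y) z = p x (p y z) - p y (p x z)) \<and>
     (\<forall>x y z. p x (br y z) = br (p x y) z + br y (p x z))"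

end

end

theory Submission
  imports Defs "HOL-Computational_Algebra.Fundamental_Theorem_Algebra"
begin

text \<open>Left multiplications \<open>p x\<close> are derivations, so \<open>\<kappa>(p x y, z)\<close>, for the Killing form \<open>\<kappa>\<close>, is symmetric
  in \<open>x, y\<close> and alternating in \<open>y, z\<close>; hence it vanishes and all products lie in the radical of \<open>\<kappa>\<close>.
  By Cartan's criterion that radical is a solvable ideal, hence contained in \<open>A\<close>. As \<open>A\<close> is abelian,
  each \<open>p x\<close> then restricts to a module endomorphism of \<open>A\<close>, which by Schur's lemma is scalar on every
  summand. So these restrictions commute, whence \<open>p [x, y]\<close> vanishes on \<open>A\<close>, and by perfectness every
  \<open>p x\<close> does. Then \<open>p x (p y z) = 0\<close>, so \<open>p [x, y] = 0\<close>, and perfectness gives \<open>p = 0\<close>.\<close>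

section \<open>Linear algebra\<close>

locale complex_fd_space = finite_dimensional_vector_space scale Basis
  for scale :: "complex \<Rightarrow> 'a::ab_group_add \<Rightarrow> 'a" (infixr "*s" 75) and Basis
begin

abbreviation endo :: "('a \<Rightarrow> 'a) \<Rightarrow> bool" where
  "endo \<equiv> Vector_Spaces.linear scale scale"

lemma endo_hom: "endo f \<Longrightarrow> module_hom scale scale f"
  by (simp add: linear_iff_module_hom)

lemmas endo_add = module_hom.add[OF endo_hom]
lemmas endo_scale = module_hom.scale[OF endo_hom]
lemmas endo_zero = module_hom.zero[OF endo_hom]
lemmas endo_neg = module_hom.neg[OF endo_hom]
lemmas endo_diff = module_hom.diff[OF endo_hom]
lemmas endo_sum = module_hom.sum[OF endo_hom]
lemmas endo_simps = endo_add endo_scale endo_zero endo_neg endo_diff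

lemma endoI:
  assumes "\<And>x y. f (x + y) = f x + f y" "\<And>c x. f (c *s x) = c *s f x"
  shows "endo f"
  unfolding Vector_Spaces.linear_iff using assms vector_space_axioms by blast

section \<open>Powers of an endomorphism and polynomials in it\<close>

lemma funpow_in: "(\<And>x. x \<in> W \<Longrightarrow> T x \<in> W) \<Longrightarrow> v \<in> W \<Longrightarrow> (T ^^ n) v \<in> W"
  by (induction n) auto

lemma endo_funpow: "endo f \<Longrightarrow> endo (f ^^ n)"
proof (induction n)
  case 0
  show ?case by (rule endoI) auto
next
  case (Suc n)
  then show ?case by (intro endoI) (simp_all add: endo_simps)
qed

lemma subspace_funpow_kernel:
  assumes "endo f"
  shows "subspace {v. \<exists>n. (f ^^ n) v = 0}"
proof -
  have mono: "(f ^^ (m + n)) v = 0" if "(f ^^ n) v = 0" for m n v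
    using that endo_zero[OF endo_funpow[OF assms]] by (simp add: funpow_add)
  show ?thesis
  proof (rule subspaceI)
    show "0 \<in> {v. \<exists>n. (f ^^ n) v = 0}" by (auto intro: exI[of _ 0])
  next
    fix x y assume "x \<in> {v. \<exists>n. (f ^^ n) v = 0}" "y \<in> {v. \<exists>n. (f ^^ n) v = 0}"
    then obtain m n where "(f ^^ m) x = 0" "(f ^^ n) y = 0" by auto
    then have "(f ^^ (m + n)) x = 0" "(f ^^ (m + n)) y = 0"
      using mono[of m x n] mono[of n y m] by (simp_all add: add.commute)
    then have "(f ^^ (m + n)) (x + y) = 0" by (simp add: endo_add[OF endo_funpow[OF assms]])
    then show "x + y \<in> {v. \<exists>n. (f ^^ n) v = 0}" by blast
  next
    fix c x assume "x \<in> {v. \<exists>n. (f ^^ n) v = 0}"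
    then show "c *s x \<in> {v. \<exists>n. (f ^^ n) v = 0}"
      by (auto simp: endo_scale[OF endo_funpow[OF assms]])
  qed
qed

text \<open>The vector \<open>p(T) v\<close>, evaluated by Horner's rule.\<close>

definition poly_map :: "('a \<Rightarrow> 'a) \<Rightarrow> complex poly \<Rightarrow> 'a \<Rightarrow> 'a" where
  "poly_map T p v = fold_coeffs (\<lambda>a w. a *s v + T w) p 0"

lemma poly_map_0 [simp]: "poly_map T 0 v = 0"
  by (simp add: poly_map_def)

lemma poly_map_pCons: "endo T \<Longrightarrow> poly_map T (pCons a p) v = a *s v + T (poly_map T p v)"
  by (cases "p = 0"; cases "a = 0") (simp_all add: poly_map_def endo_zero)

lemma poly_map_add:
  assumes "endo T"
  shows "poly_map T (p + q) v = poly_map T p v + poly_map T q v"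
  by (induction p q rule: poly_induct2)
    (simp_all add: poly_map_pCons[OF assms] endo_add[OF assms] scale_left_distrib algebra_simps)

lemma poly_map_smult:
  assumes "endo T"
  shows "poly_map T (smult c p) v = c *s poly_map T p v"
  by (induction p)
    (simp_all add: poly_map_pCons[OF assms] endo_scale[OF assms] scale_right_distrib)

lemma poly_map_monom:
  assumes "endo T"
  shows "poly_map T (monom c n) v = c *s (T ^^ n) v"
  by (induction n)
    (simp_all add: monom_0 monom_Suc poly_map_pCons[OF assms] endo_zero[OF assms] endo_scale[OF assms])

lemma poly_map_linear_factor:
  assumes "endo T"
  shows "poly_map T ([:- c, 1:] * p) v = T (poly_map T p v) - c *s poly_map T p v"
  using poly_map_add[OF assms, of "smult (- c) p" "pCons 0 p" v]
    poly_map_smult[OF assms, of "- c" p v]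
  by (simp add: poly_map_pCons[OF assms] del: smult_minus_left)

text \<open>Finite dimension bounds the number of independent iterates \<open>(T ^^ i) v\<close>, so
  some iterate is a combination of the earlier ones. The polynomial may depend on \<open>v\<close>,
  which is enough for \<open>quotient_eigenvector\<close>.\<close>

lemma annihilating_poly:
  assumes T: "endo T"
  shows "\<exists>p. p \<noteq> 0 \<and> poly_map T p v = 0"
proof -
  have "\<exists>k. (T ^^ k) v \<in> span ((\<lambda>i. (T ^^ i) v) ` {..<k})"
  proof (rule ccontr)
    assume no: "\<not> ?thesis"
    let ?S = "\<lambda>k. (\<lambda>i. (T ^^ i) v) ` {..<k}"
    have *: "independent (?S k) \<and> card (?S k) = k" for k
    proof (induction k)
      case 0
      show ?case using independent_empty by simp
    next
      case (Suc k)
      have S: "?S (Suc k) = insert ((T ^^ k) v) (?S k)" by (simp add: lessThan_Suc)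
      have k: "(T ^^ k) v \<notin> span (?S k)" using no by blast
      then have "(T ^^ k) v \<notin> ?S k" by (meson span_base)
      with Suc independent_insertI[OF k] show ?case unfolding S by (subst card_insert_disjoint) auto
    qed
    have "card (?S (Suc dimension)) \<le> dim (UNIV :: 'a set)"
      using * independent_card_le_dim by blast
    then show False unfolding conjunct2[OF *] by (simp add: dimension_def)
  qed
  then obtain k where k: "(T ^^ k) v \<in> span ((\<lambda>i. (T ^^ i) v) ` {..<k})" by blast
  \<comment> \<open>The alternative \<open>q = 0\<close> covers \<open>k = 0\<close>, where no
    degree is below \<open>k\<close>.\<close>
  let ?R = "{poly_map T q v | q. q = 0 \<or> degree q < k}"
  have "subspace ?R"
  proof (rule subspaceI)
    show "0 \<in> ?R" by (auto intro: exI[of _ 0])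
  next
    fix x y assume "x \<in> ?R" "y \<in> ?R"
    then obtain q r where "x = poly_map T q v" "q = 0 \<or> degree q < k"
      "y = poly_map T r v" "r = 0 \<or> degree r < k" by auto
    then show "x + y \<in> ?R"
      by (auto intro!: exI[of _ "q + r"] simp: poly_map_add[OF T] degree_add_less)
  next
    fix c x assume "x \<in> ?R"
    then obtain q where "x = poly_map T q v" "q = 0 \<or> degree q < k" by auto
    then show "c *s x \<in> ?R"
      by (auto intro!: exI[of _ "smult c q"] simp: poly_map_smult[OF T] split: if_splits)
  qed
  moreover have "(\<lambda>i. (T ^^ i) v) ` {..<k} \<subseteq> ?R"
  proof (rule image_subsetI)
    fix i assume "i \<in> {..<k}"
    then show "(T ^^ i) v \<in> ?R"
      by (auto intro!: exI[of _ "monom 1 i"] simp: poly_map_monom[OF T] degree_monom_eq)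
  qed
  ultimately have "span ((\<lambda>i. (T ^^ i) v) ` {..<k}) \<subseteq> ?R" by (rule span_minimal[rotated])
  then obtain q where q: "(T ^^ k) v = poly_map T q v" "q = 0 \<or> degree q < k" using k by blast
  let ?p = "monom 1 k + smult (- 1) q"
  have "coeff ?p k \<noteq> 0" using q(2) by (auto simp: coeff_eq_0)
  then have "?p \<noteq> 0" by fastforce
  moreover have "poly_map T ?p v = 0"
    by (simp add: poly_map_add[OF T] poly_map_monom[OF T] poly_map_smult[OF T] q(1)
        del: smult_minus_left)
  ultimately show ?thesis by blast
qed

text \<open>Split a polynomial annihilating \<open>v\<close> into linear factors and apply them to
  \<open>v\<close> one by one: the last vector outside \<open>W\<close> is an eigenvector modulo
  \<open>W\<close>. Working with representatives avoids forming the quotient space.\<close>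

lemma quotient_eigenvector:
  assumes T: "endo T" and W: "subspace W" and U: "subspace U"
    and WT: "\<And>x. x \<in> W \<Longrightarrow> T x \<in> W" and UT: "\<And>x. x \<in> U \<Longrightarrow> T x \<in> U"
    and v: "v \<in> U" "v \<notin> W"
  obtains u c where "u \<in> U" "u \<notin> W" "T u - c *s u \<in> W"
proof -
  obtain p where "p \<noteq> 0" "poly_map T p v = 0" using annihilating_poly[OF T] by blast
  then have "poly_map T p v \<in> W" using subspace_0[OF W] by simp
  have inU: "poly_map T q v \<in> U" for q
    by (induction q)
      (simp_all add: poly_map_pCons[OF T] subspace_0[OF U] subspace_add[OF U] subspace_scale[OF U] UT v)
  from \<open>p \<noteq> 0\<close> \<open>poly_map T p v \<in> W\<close> have "\<exists>u c. u \<in> U \<and> u \<notin> W \<and> T u - c *s u \<in> W"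
  proof (induction "degree p" arbitrary: p rule: less_induct)
    case less
    show ?case
    proof (cases "degree p = 0")
      case True
      then obtain a where p: "p = [:a:]" by (rule degree_eq_zeroE)
      with less.prems have a: "a \<noteq> 0" "a *s v \<in> W"
        by (auto simp: poly_map_pCons[OF T] endo_zero[OF T])
      then have "inverse a *s a *s v \<in> W" using subspace_scale[OF W] by blast
      with a v show ?thesis by simp
    next
      case False
      then obtain c where "poly p c = 0" using alg_closed_imp_poly_has_root by blast
      then obtain q where q: "p = [:- c, 1:] * q" using dvdE poly_eq_0_iff_dvd by metis
      then have "q \<noteq> 0" using less.prems by auto
      then have "degree q < degree p" unfolding q by (subst degree_mult_eq) auto
      \<comment> \<open>If \<open>poly_map T q v\<close> lies in \<open>W\<close>, continue with
        \<open>q\<close>; otherwise it is the eigenvector, with eigenvalue \<open>c\<close>.\<close>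
      then show ?thesis
        using less q \<open>q \<noteq> 0\<close> inU[of q] poly_map_linear_factor[OF T, of c q v] by metis
    qed
  qed
  with that show ?thesis by blast
qed

section \<open>Generalized eigenspaces\<close>

text \<open>Available for every \<open>c\<close>: for linear \<open>T\<close> the space is
  \<open>{0}\<close> unless \<open>c\<close> is an eigenvalue, so no list of eigenvalues has to be
  carried around.\<close>

definition gen_eig :: "('a \<Rightarrow> 'a) \<Rightarrow> complex \<Rightarrow> 'a set" where
  "gen_eig T c = {v. \<exists>n. ((\<lambda>x. T x - c *s x) ^^ n) v = 0}"

lemma endo_shift: "endo T \<Longrightarrow> endo (\<lambda>x. T x - c *s x)"
  by (rule endoI) (simp_all add: endo_simps scale_right_distrib scale_right_diff_distrib scale_left_commute)

lemma subspace_gen_eig: "endo T \<Longrightarrow> subspace (gen_eig T c)"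
  unfolding gen_eig_def by (rule subspace_funpow_kernel[OF endo_shift])

text \<open>Induction on the exponent that annihilates \<open>v\<close>: applying
  \<open>T - c\<close> once lowers it by one.\<close>

lemma gen_eig_induct [consumes 2, case_names zero step]:
  assumes "endo T" "v \<in> gen_eig T c"
    and zero: "P 0"
    and step: "\<And>v. v \<in> gen_eig T c \<Longrightarrow> T v - c *s v \<in> gen_eig T c \<Longrightarrow> P (T v - c *s v) \<Longrightarrow> P v"
  shows "P v"
proof -
  obtain n where "((\<lambda>x. T x - c *s x) ^^ n) v = 0" using assms(2) unfolding gen_eig_def by blast
  then show ?thesis
  proof (induction n arbitrary: v)
    case 0
    then show ?case using zero by simp
  next
    case (Suc n)
    then have n: "((\<lambda>x. T x - c *s x) ^^ n) (T v - c *s v) = 0"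
      by (simp add: funpow_Suc_right del: funpow.simps)
    show ?case
    proof (rule step)
      show "v \<in> gen_eig T c" unfolding gen_eig_def using Suc.prems by blast
      show "T v - c *s v \<in> gen_eig T c" unfolding gen_eig_def using n by blast
      show "P (T v - c *s v)" using Suc.IH[OF n] .
    qed
  qed
qed

lemma gen_eig_shiftD:
  assumes "T v - c *s v \<in> gen_eig T c"
  shows "v \<in> gen_eig T c"
proof -
  from assms obtain n where "((\<lambda>x. T x - c *s x) ^^ n) (T v - c *s v) = 0"
    unfolding gen_eig_def by blast
  then have "((\<lambda>x. T x - c *s x) ^^ Suc n) v = 0"
    by (simp add: funpow_Suc_right del: funpow.simps)
  then show ?thesis unfolding gen_eig_def by blast
qed

lemma gen_eig_map:
  assumes T: "endo T" and v: "v \<in> gen_eig T c"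
  shows "T v \<in> gen_eig T c"
proof -
  have "v \<in> gen_eig T c \<Longrightarrow> T v - c *s v \<in> gen_eig T c" using T v
    by (induction rule: gen_eig_induct)
     (simp_all add: endo_zero[OF T] subspace_0[OF subspace_gen_eig[OF T]])
  then show ?thesis
    using v subspace_add[OF subspace_gen_eig[OF T], of "T v - c *s v" c "c *s v"]
      subspace_scale[OF subspace_gen_eig[OF T]] by simp
qed

lemma gen_eig_shift:
  assumes T: "endo T" and v: "v \<in> gen_eig T c"
  shows "T v - d *s v \<in> gen_eig T c"
  using assms gen_eig_map subspace_diff subspace_gen_eig subspace_scale by metis

text \<open>On such a \<open>v\<close> the map \<open>T - c\<close> is multiplication by the nonzero
  scalar \<open>d - c\<close>, and yet some power of it gives 0.\<close>

lemma gen_eig_shift_inj: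
  assumes T: "endo T" and v: "v \<in> gen_eig T c" and "T v = d *s v" "d \<noteq> c"
  shows "v = 0"
  using T v assms(3)
proof (induction rule: gen_eig_induct)
  case zero
  show ?case by simp
next
  case (step v)
  have "T v - c *s v = (d - c) *s v" using step by (simp add: scale_left_diff_distrib)
  moreover have "T v - c *s v = 0"
    using step by (intro step.IH) (simp add: endo_simps[OF T] scale_right_diff_distrib scale_left_commute)
  ultimately show ?case using \<open>d \<noteq> c\<close> by simp
qed

text \<open>By induction in the space for \<open>d\<close>, \<open>(T - d) v\<close> vanishes; so
  \<open>v\<close> satisfies \<open>T v = d *s v\<close>, which forces \<open>v = 0\<close> in the
  space for \<open>c\<close>.\<close>

lemma gen_eig_inter:
  assumes T: "endo T" and v: "v \<in> gen_eig T c" and d: "v \<in> gen_eig T d" "d \<noteq> c"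
  shows "v = 0"
  using T d(1) v
proof (induction rule: gen_eig_induct)
  case zero
  show ?case by simp
next
  case (step v)
  then have "T v - d *s v = 0" using gen_eig_shift[OF T] by blast
  then have "T v = d *s v" by simp
  then show ?case by (rule gen_eig_shift_inj[OF T step.prems _ d(2)])
qed

text \<open>On the space for \<open>c\<close>, \<open>T - d\<close> is the nonzero scalar
  \<open>c - d\<close> plus a nilpotent map, hence invertible.\<close>

lemma gen_eig_shift_surj:
  assumes T: "endo T" and w: "w \<in> gen_eig T c" and "d \<noteq> c"
  shows "\<exists>z\<in>gen_eig T c. T z - d *s z = w"
  using T w
proof (induction rule: gen_eig_induct)
  case zero
  show ?case using subspace_0[OF subspace_gen_eig[OF T]] by (auto intro!: bexI[of _ 0] simp: endo_zero[OF T])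
next
  case (step w)
  then obtain z where z: "z \<in> gen_eig T c" "T z - d *s z = T w - c *s w" by blast
  \<comment> \<open>Since \<open>(T - d) w - (T - c) w = (c - d) w\<close>, the vector
    \<open>w - z\<close> is a preimage of \<open>(c - d) w\<close>.\<close>
  let ?y = "inverse (c - d) *s (w - z)"
  have "T (w - z) - d *s (w - z) = (T w - d *s w) - (T z - d *s z)"
    by (simp add: endo_diff[OF T] scale_right_diff_distrib)
  also have "\<dots> = (c - d) *s w" unfolding z(2) by (simp add: scale_left_diff_distrib)
  finally have "inverse (c - d) *s (T (w - z) - d *s (w - z)) = w" using \<open>d \<noteq> c\<close> by simp
  then have "T ?y - d *s ?y = w"
    by (metis endo_scale[OF T] scale_right_diff_distrib scale_left_commute)
  moreover have "?y \<in> gen_eig T c"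
    using subspace_scale[OF subspace_gen_eig[OF T]] subspace_diff[OF subspace_gen_eig[OF T]] step(1) z(1)
    by blast
  ultimately show ?case by blast
qed

text \<open>A power of \<open>T - d\<close> that annihilates \<open>v d\<close> preserves the other
  spaces. By induction it annihilates the other summands as well, so these also lie in the space for
  \<open>d\<close> and vanish by \<open>gen_eig_inter\<close>.\<close>

lemma gen_eig_independent:
  assumes T: "endo T" and "finite F" and "\<And>c. c \<in> F \<Longrightarrow> v c \<in> gen_eig T c" and "(\<Sum>c\<in>F. v c) = 0" and "c \<in> F"
  shows "v c = 0"
  using assms(2-)
proof (induction F arbitrary: v c)
  case empty
  then show ?case by simp
next
  case (insert d F)
  let ?S = "\<lambda>x. T x - d *s x"
  obtain n where n: "(?S ^^ n) (v d) = 0" using insert.prems(1)[of d] unfolding gen_eig_def by blast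
  have "(?S ^^ n) (\<Sum>c\<in>insert d F. v c) = 0"
    unfolding insert.prems by (rule endo_zero[OF endo_funpow[OF endo_shift[OF T]]])
  then have "(\<Sum>c\<in>F. (?S ^^ n) (v c)) = 0"
    using insert.hyps n by (simp add: endo_add[OF endo_funpow[OF endo_shift[OF T]]] endo_sum[OF endo_funpow[OF endo_shift[OF T]]])
  moreover have "(?S ^^ n) (v c) \<in> gen_eig T c" if "c \<in> F" for c
    using that insert.prems(1) by (intro funpow_in gen_eig_shift[OF T]) auto
  ultimately have "(?S ^^ n) (v c) = 0" if "c \<in> F" for c
    using insert.IH[of "\<lambda>c. (?S ^^ n) (v c)"] that by blast
  then have "v c \<in> gen_eig T d" if "c \<in> F" for c unfolding gen_eig_def using that by blast
  then have F: "v c = 0" if "c \<in> F" for c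
    using gen_eig_inter[OF T, of "v c" c d] insert.prems(1) insert.hyps(2) that by blast
  then have "v d = 0" using insert.prems(2) insert.hyps by simp
  with F insert.prems(3) show ?case by blast
qed

text \<open>If the span were proper, some \<open>u\<close> outside it would be an eigenvector modulo
  the span, with eigenvalue \<open>d\<close>. Correcting \<open>u\<close> by an element of the span
  turns it into a generalized eigenvector for \<open>d\<close>, which lies in the span after
  all.\<close>

lemma span_gen_eig:
  assumes T: "endo T"
  shows "span (\<Union>c. gen_eig T c) = UNIV"
proof (rule ccontr)
  let ?G = "\<Union>c. gen_eig T c" and ?W = "span (\<Union>c. gen_eig T c)"
  assume "?W \<noteq> UNIV"
  then obtain v where "v \<notin> ?W" by blast
  have "T ` ?W \<subseteq> ?W"
    unfolding module_hom.span_image[OF endo_hom[OF T], symmetric]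
    by (rule span_mono) (use gen_eig_map[OF T] in blast)
  then obtain u d where u: "u \<notin> ?W" "T u - d *s u \<in> ?W"
    using quotient_eigenvector[OF T subspace_span[of ?G] subspace_UNIV _ _ UNIV_I \<open>v \<notin> ?W\<close>] by (metis UNIV_I image_subset_iff)
  \<comment> \<open>\<open>T - d\<close> is onto on each space with \<open>c \<noteq> d\<close>; so,
    modulo the space for \<open>d\<close>, it maps \<open>?W\<close> onto itself.\<close>
  have "\<exists>z\<in>?W. w - (T z - d *s z) \<in> gen_eig T d" if "w \<in> ?W" for w
    using that
  proof (induction rule: span_induct_alt)
    case base
    show ?case by (rule bexI[of _ 0]) (simp_all add: endo_zero[OF T] span_zero subspace_0[OF subspace_gen_eig[OF T]])
  next
    case (step a x y)
    then obtain z where z: "z \<in> ?W" "y - (T z - d *s z) \<in> gen_eig T d" by blast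
    obtain c where c: "x \<in> gen_eig T c" using step by blast
    show ?case
    proof (cases "c = d")
      case True
      then have "a *s x + (y - (T z - d *s z)) \<in> gen_eig T d"
        using c z(2) subspace_add[OF subspace_gen_eig[OF T]] subspace_scale[OF subspace_gen_eig[OF T]] by blast
      then show ?thesis using z(1) by (auto simp: algebra_simps)
    next
      case False
      then obtain t where t: "t \<in> gen_eig T c" "T t - d *s t = x" using gen_eig_shift_surj[OF T c, of d] by metis
      have "T (a *s t + z) - d *s (a *s t + z) = a *s (T t - d *s t) + (T z - d *s z)"
        by (simp add: endo_simps[OF T] scale_right_distrib scale_right_diff_distrib scale_left_commute)
      then have "a *s x + y - (T (a *s t + z) - d *s (a *s t + z)) \<in> gen_eig T d"
        using z(2) t(2) by simp
      moreover have "a *s t + z \<in> ?W" using t(1) z(1) by (intro span_add span_scale) (auto intro: span_base)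
      ultimately show ?thesis by blast
    qed
  qed
  then obtain z where z: "z \<in> ?W" "T u - d *s u - (T z - d *s z) \<in> gen_eig T d" using u(2) by blast
  then have "T (u - z) - d *s (u - z) \<in> gen_eig T d"
    by (simp add: endo_diff[OF T] scale_right_diff_distrib algebra_simps)
  then have "u - z \<in> ?W" by (intro span_base) (use gen_eig_shiftD in blast)
  then have "u - z + z \<in> ?W" using z(1) by (rule span_add)
  with u(1) show False by simp
qed

section \<open>Direct sums of families of subspaces\<close>

definition direct_family :: "'i set \<Rightarrow> ('i \<Rightarrow> 'a set) \<Rightarrow> bool" where
  "direct_family I V \<longleftrightarrow> finite I \<and> (\<forall>i\<in>I. subspace (V i)) \<and>
     (\<forall>v. (\<forall>i\<in>I. v i \<in> V i) \<and> (\<Sum>i\<in>I. v i) = 0 \<longrightarrow> (\<forall>i\<in>I. v i = 0))"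

definition family_sum :: "'i set \<Rightarrow> ('i \<Rightarrow> 'a set) \<Rightarrow> 'a set" where
  "family_sum I V = {\<Sum>i\<in>I. v i | v. \<forall>i\<in>I. v i \<in> V i}"

text \<open>A chosen decomposition: unspecified outside \<open>family_sum I V\<close>, and unique on
  it once the family is direct.\<close>

definition component :: "'i set \<Rightarrow> ('i \<Rightarrow> 'a set) \<Rightarrow> 'a \<Rightarrow> 'i \<Rightarrow> 'a" where
  "component I V x = (SOME v. (\<forall>i\<in>I. v i \<in> V i) \<and> (\<Sum>i\<in>I. v i) = x)"

lemma component_spec:
  assumes "x \<in> family_sum I V"
  shows "(\<forall>i\<in>I. component I V x i \<in> V i) \<and> (\<Sum>i\<in>I. component I V x i) = x"
proof -
  from assms have "\<exists>v. (\<forall>i\<in>I. v i \<in> V i) \<and> (\<Sum>i\<in>I. v i) = x"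
    unfolding family_sum_def by blast
  then show ?thesis unfolding component_def by (rule someI_ex)
qed

lemma component_in: "x \<in> family_sum I V \<Longrightarrow> i \<in> I \<Longrightarrow> component I V x i \<in> V i"
  using component_spec by blast

lemma sum_component: "x \<in> family_sum I V \<Longrightarrow> (\<Sum>i\<in>I. component I V x i) = x"
  using component_spec by blast

text \<open>Two decompositions of \<open>x\<close> differ by one of 0. The rules for
  \<open>component\<close> below all follow by exhibiting a decomposition.\<close>

lemma component_eq:
  assumes "direct_family I V" "\<And>i. i \<in> I \<Longrightarrow> v i \<in> V i" "(\<Sum>i\<in>I. v i) = x" "i \<in> I"
  shows "component I V x i = v i"
proof -
  have x: "x \<in> family_sum I V" using assms(2,3) unfolding family_sum_def by blast
  have "(\<Sum>i\<in>I. component I V x i - v i) = 0"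
    using sum_component[OF x] assms(3) by (simp add: sum_subtractf)
  moreover have "component I V x i - v i \<in> V i" if "i \<in> I" for i
    using that assms(1,2) component_in[OF x] subspace_diff unfolding direct_family_def by metis
  ultimately have "\<forall>i\<in>I. component I V x i - v i = 0"
    using assms(1) unfolding direct_family_def by (elim conjE allE[of _ "\<lambda>i. component I V x i - v i"]) blast
  then show ?thesis using assms(4) by simp
qed

lemma component_add:
  assumes "direct_family I V" "x \<in> family_sum I V" "y \<in> family_sum I V" "i \<in> I"
  shows "component I V (x + y) i = component I V x i + component I V y i"
proof (rule component_eq[OF assms(1) _ _ assms(4)])
  show "component I V x j + component I V y j \<in> V j" if "j \<in> I" for j
    using that assms component_in subspace_add unfolding direct_family_def by metis
  show "(\<Sum>j\<in>I. component I V x j + component I V y j) = x + y"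
    using assms by (simp add: sum.distrib sum_component)
qed

lemma component_scale:
  assumes "direct_family I V" "x \<in> family_sum I V" "i \<in> I"
  shows "component I V (c *s x) i = c *s component I V x i"
proof (rule component_eq[OF assms(1) _ _ assms(3)])
  show "c *s component I V x j \<in> V j" if "j \<in> I" for j
    using that assms component_in subspace_scale unfolding direct_family_def by metis
  show "(\<Sum>j\<in>I. c *s component I V x j) = c *s x"
    using assms by (simp add: scale_sum_right[symmetric] sum_component)
qed

lemma component_map:
  assumes "direct_family I V" "x \<in> family_sum I V" "i \<in> I" "endo f"
    and "\<And>i v. i \<in> I \<Longrightarrow> v \<in> V i \<Longrightarrow> f v \<in> V i"
  shows "component I V (f x) i = f (component I V x i)"
proof (rule component_eq[OF assms(1) _ _ assms(3)])
  show "f (component I V x j) \<in> V j" if "j \<in> I" for j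
    using that assms component_in by metis
  show "(\<Sum>j\<in>I. f (component I V x j)) = f x"
    using assms by (simp add: endo_sum[symmetric] sum_component)
qed

lemma component_single:
  assumes "direct_family I V" "i \<in> I" "v \<in> V i" "j \<in> I"
  shows "component I V v j = (if j = i then v else 0)"
proof (rule component_eq[OF assms(1) _ _ assms(4)])
  show "(if j = i then v else 0) \<in> V j" if "j \<in> I" for j
    using that assms unfolding direct_family_def by (simp add: subspace_0)
  show "(\<Sum>j\<in>I. if j = i then v else 0) = v"
    using assms unfolding direct_family_def by simp
qed

lemma subspace_family_sum:
  assumes "\<And>i. i \<in> I \<Longrightarrow> subspace (V i)"
  shows "subspace (family_sum I V)"
proof (rule subspaceI)
  show "0 \<in> family_sum I V"
    unfolding family_sum_def using assms subspace_0 by (auto intro!: exI[of _ "\<lambda>_. 0"])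
next
  fix x y assume "x \<in> family_sum I V" "y \<in> family_sum I V"
  then obtain v w where "\<forall>i\<in>I. v i \<in> V i" "x = sum v I" "\<forall>i\<in>I. w i \<in> V i" "y = sum w I"
    unfolding family_sum_def by blast
  then show "x + y \<in> family_sum I V"
    unfolding family_sum_def using assms subspace_add
    by (auto intro!: exI[of _ "\<lambda>i. v i + w i"] simp: sum.distrib)
next
  fix c x assume "x \<in> family_sum I V"
  then obtain v where "\<forall>i\<in>I. v i \<in> V i" "x = sum v I"
    unfolding family_sum_def by blast
  then show "c *s x \<in> family_sum I V"
    unfolding family_sum_def using assms subspace_scale
    by (auto intro!: exI[of _ "\<lambda>i. c *s v i"] simp: scale_sum_right)
qed

lemma family_sum_single:
  assumes "finite I" "\<And>i. i \<in> I \<Longrightarrow> subspace (V i)" "i \<in> I" "v \<in> V i"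
  shows "v \<in> family_sum I V"
  unfolding family_sum_def using assms subspace_0
  by (auto intro!: exI[of _ "\<lambda>j. if j = i then v else 0"])

section \<open>Maps prescribed on generalized eigenspaces, and triangular bases\<close>

text \<open>\<open>T'\<close> is \<open>f\<close> applied to the semisimple part of
  \<open>T\<close>: decompose into generalized eigenvectors and multiply each by \<open>f\<close> of
  its eigenvalue. As \<open>f\<close> is arbitrary, complex conjugation is allowed.\<close>

lemma gen_eig_multiplier:
  assumes T: "endo T"
  obtains T' where "endo T'" "\<And>c v. v \<in> gen_eig T c \<Longrightarrow> T' v = f c *s v"
proof -
  let ?G = "gen_eig T"
  \<comment> \<open>A basis of generalized eigenvectors is finite and so yields a finite set
    \<open>F\<close> of eigenvalues whose spaces already sum to everything.\<close>
  obtain B where B: "B \<subseteq> (\<Union>c. ?G c)" "independent B" "(\<Union>c. ?G c) \<subseteq> span B"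
    using maximal_independent_subset by blast
  have spanB: "span B = UNIV" using span_gen_eig[OF T] span_minimal[OF B(3) subspace_span] by blast
  have "\<forall>b\<in>B. \<exists>c. b \<in> ?G c" using B(1) by blast
  then obtain l where l: "b \<in> ?G (l b)" if "b \<in> B" for b by metis
  define F where "F = l ` B"
  have F: "finite F" unfolding F_def using finiteI_independent[OF B(2)] by simp
  have sub: "subspace (?G c)" for c using subspace_gen_eig[OF T] .
  have dir: "direct_family F ?G"
    unfolding direct_family_def using F sub gen_eig_independent[OF T F] by blast
  have "B \<subseteq> family_sum F ?G"
  proof
    fix b assume "b \<in> B"
    then show "b \<in> family_sum F ?G"
      by (intro family_sum_single[OF F sub, of "l b"] l) (simp add: F_def)
  qed
  then have "span B \<subseteq> family_sum F ?G" by (rule span_minimal) (rule subspace_family_sum[OF sub])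
  then have all: "x \<in> family_sum F ?G" for x unfolding spanB by (rule subsetD) (rule UNIV_I)
  define T' where "T' x = (\<Sum>c\<in>F. f c *s component F ?G x c)" for x
  have endo: "endo T'" unfolding T'_def
    by (rule endoI)
      (simp_all add: component_add[OF dir all all] component_scale[OF dir all] scale_right_distrib
        sum.distrib scale_sum_right mult.commute)
  show ?thesis
  proof (rule that[OF endo])
    fix c v assume v: "v \<in> ?G c"
    show "T' v = f c *s v"
    proof (cases "c \<in> F")
      case True
      have "T' v = (\<Sum>d\<in>F. if d = c then f c *s v else 0)"
        unfolding T'_def by (rule sum.cong) (simp_all add: component_single[OF dir True v])
      then show ?thesis using F True by simp
    next
      case False
      \<comment> \<open>For \<open>c\<close> outside \<open>F\<close>, the decomposition of
        \<open>v\<close> over \<open>F\<close> together with \<open>- v\<close> is a relation over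
        \<open>insert c F\<close>, so \<open>v = 0\<close>.\<close>
      let ?w = "\<lambda>d. if d = c then - v else component F ?G v d"
      have "(\<Sum>d\<in>insert c F. ?w d) = - v + (\<Sum>d\<in>F. component F ?G v d)"
        using F False by (auto intro!: sum.cong)
      also have "\<dots> = 0" by (simp add: sum_component[OF all])
      finally have sum0: "(\<Sum>d\<in>insert c F. ?w d) = 0" .
      have "?w d \<in> ?G d" if "d \<in> insert c F" for d
        using that v component_in[OF all] subspace_neg[OF sub] by auto
      from gen_eig_independent[OF T finite.insertI[OF F] this sum0 insertI1]
      have "v = 0" by simp
      then show ?thesis using endo_zero[OF endo] by simp
    qed
  qed
qed

text \<open>As long as \<open>B\<close> does not span, it can be enlarged by a generalized
  eigenvector \<open>u\<close> with \<open>(T - c) u\<close> in its span; hence a largest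
  \<open>B\<close> is a basis. The order of adjunction, in which \<open>T\<close> is triangular, is
  not recorded, because a trace sees only the diagonal.\<close>

lemma triangular_basis:
  assumes T: "endo T"
  obtains B l where "independent B" "span B = UNIV"
    "\<And>b. b \<in> B \<Longrightarrow> b \<in> gen_eig T (l b)" "\<And>b. b \<in> B \<Longrightarrow> representation B (T b) b = l b"
proof -
  define P where "P B \<longleftrightarrow> independent B \<and> (\<forall>x\<in>span B. T x \<in> span B) \<and>
    (\<forall>b\<in>B. b \<in> gen_eig T (representation B (T b) b))" for B
  have "P {}" unfolding P_def using endo_zero[OF T] independent_empty by simp
  moreover have "card B \<le> card Basis" if "P B" for B
    using that independent_card_le_dim[of B UNIV] unfolding P_def by simp
  ultimately obtain B where B: "P B" and max: "\<And>C. P C \<Longrightarrow> card C \<le> card B"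
    using ex_has_greatest_nat[of P "{}" card "Suc (card Basis)"] by (metis le_imp_less_Suc)
  have ind: "independent B" and inv: "\<And>x. x \<in> span B \<Longrightarrow> T x \<in> span B"
    and rep: "\<And>b. b \<in> B \<Longrightarrow> b \<in> gen_eig T (representation B (T b) b)"
    using B unfolding P_def by blast+
  have "span B = UNIV"
  proof (rule ccontr)
    assume "span B \<noteq> UNIV"
    then have "\<not> (\<Union>c. gen_eig T c) \<subseteq> span B"
      using span_gen_eig[OF T] span_minimal[OF _ subspace_span] by blast
    then obtain v c where v: "v \<in> gen_eig T c" "v \<notin> span B" by blast
    \<comment> \<open>If \<open>(T - c) v\<close> is in the span, \<open>v\<close> itself serves;
      otherwise pass to \<open>(T - c) v\<close>.\<close>
    have "v \<notin> span B \<longrightarrow> (\<exists>u\<in>gen_eig T c. u \<notin> span B \<and> T u - c *s u \<in> span B)"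
      using T v(1) by (induction rule: gen_eig_induct) (auto simp: span_zero)
    then obtain u where u: "u \<in> gen_eig T c" "u \<notin> span B" "T u - c *s u \<in> span B" using v by blast
    let ?C = "insert u B"
    have C: "independent ?C" using independent_insertI[OF u(2) ind] .
    have "u \<notin> B" using u(2) span_base by metis
    have BC: "span B \<subseteq> span ?C" by (rule span_mono) blast
    have rep_ext: "representation ?C x = representation B x" if "x \<in> span B" for x
      using representation_extend[OF C that] by blast
    \<comment> \<open>\<open>T u\<close> is \<open>c *s u\<close> plus a vector of
      \<open>span B\<close>, so its diagonal entry is \<open>c\<close>; the entries of the old
      vectors do not change.\<close>
    have "representation ?C (T u - c *s u) u = 0"
      unfolding rep_ext[OF u(3)] using \<open>u \<notin> B\<close> representation_ne_zero by blast
    moreover have "T u \<in> span ?C"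
      using span_add[of "T u - c *s u" ?C "c *s u"] u(3) BC span_scale[OF span_base[of u ?C]] by auto
    ultimately have repu: "representation ?C (T u) u = c"
      using C by (simp add: representation_diff representation_scale representation_basis span_base span_scale)
    have Tspan: "T x \<in> span ?C" if "x \<in> span ?C" for x
    proof -
      have "T ` ?C \<subseteq> span ?C" using \<open>T u \<in> span ?C\<close> inv span_base[of _ B] BC by auto
      then have "span (T ` ?C) \<subseteq> span ?C" by (rule span_minimal) (rule subspace_span)
      then show ?thesis using that unfolding module_hom.span_image[OF endo_hom[OF T]] by blast
    qed
    have "P ?C" unfolding P_def
      using C Tspan rep repu u(1) rep_ext[OF inv[OF span_base]] by auto
    then have "card ?C \<le> card B" by (rule max)
    then show False using \<open>u \<notin> B\<close> finiteI_independent[OF ind] by simp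
  qed
  then show ?thesis using that[of B "\<lambda>b. representation B (T b) b"] ind rep by blast
qed

section \<open>Traces\<close>

definition trace :: "('a \<Rightarrow> 'a) \<Rightarrow> complex" where
  "trace f = (\<Sum>b\<in>Basis. representation Basis (f b) b)"

text \<open>Commutativity (\<open>B = C\<close>) and basis independence (\<open>f = id\<close>) of the trace in one statement.\<close>

lemma sum_representation_swap:
  assumes B: "independent B" "span B = UNIV" and C: "independent C" "span C = UNIV"
    and f: "endo f" and g: "endo g"
  shows "(\<Sum>b\<in>B. representation B (g (f b)) b) = (\<Sum>c\<in>C. representation C (f (g c)) c)"
proof -
  have expand: "representation B (g (f b)) b =
      (\<Sum>c\<in>C. representation C (f b) c * representation B (g c) b)"
    if "independent B" "span B = UNIV" "independent C" "span C = UNIV" "endo g" for B C f g b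
  proof -
    have "f b = (\<Sum>c\<in>C. representation C (f b) c *s c)"
      using that by (simp add: sum_representation_eq[of C "f b" C] finiteI_independent)
    then have "g (f b) = (\<Sum>c\<in>C. representation C (f b) c *s g c)"
      using endo_sum[OF \<open>endo g\<close>] endo_scale[OF \<open>endo g\<close>] by (metis (no_types, lifting) sum.cong)
    then show ?thesis using that by (simp add: representation_sum representation_scale)
  qed
  have "(\<Sum>b\<in>B. representation B (g (f b)) b) =
      (\<Sum>b\<in>B. \<Sum>c\<in>C. representation C (f b) c * representation B (g c) b)"
    by (rule sum.cong[OF refl expand[OF B C g]])
  also have "\<dots> = (\<Sum>c\<in>C. \<Sum>b\<in>B. representation B (g c) b * representation C (f b) c)"
    by (subst sum.swap) (simp add: mult.commute)
  also have "\<dots> = (\<Sum>c\<in>C. representation C (f (g c)) c)"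
    by (rule sum.cong[OF refl expand[OF C B f, symmetric]])
  finally show ?thesis .
qed

lemma Basis_basis: "independent Basis" "span Basis = UNIV"
  using independent_Basis span_Basis by blast+

lemma endo_comp: "endo f \<Longrightarrow> endo g \<Longrightarrow> endo (\<lambda>x. f (g x))"
  by (rule endoI) (simp_all add: endo_simps)

lemma trace_commute: "endo f \<Longrightarrow> endo g \<Longrightarrow> trace (\<lambda>x. f (g x)) = trace (\<lambda>x. g (f x))"
  unfolding trace_def using sum_representation_swap[OF Basis_basis Basis_basis] by blast

lemma trace_basis:
  assumes "independent B" "span B = UNIV" "endo f"
  shows "trace f = (\<Sum>b\<in>B. representation B (f b) b)"
  unfolding trace_def
  using sum_representation_swap[OF Basis_basis assms(1,2) endoI[of "\<lambda>x. x"] assms(3)] by simp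

lemma trace_add: "trace (\<lambda>x. f x + g x) = trace f + trace g"
  by (simp add: trace_def Basis_basis representation_add sum.distrib)

lemma trace_diff: "trace (\<lambda>x. f x - g x) = trace f - trace g"
  by (simp add: trace_def Basis_basis representation_diff sum_subtractf)

lemma trace_scale: "trace (\<lambda>x. c *s f x) = c * trace f"
  by (simp add: trace_def Basis_basis representation_scale sum_distrib_left)

lemma trace_zero: "trace (\<lambda>x. 0) = 0"
  by (simp add: trace_def representation_zero)

text \<open>In a triangular basis for \<open>T\<close> the trace below is the sum of the squared absolute values of
  the eigenvalues of \<open>T\<close>.\<close>

lemma nilpotent_if_trace_cnj_part_eq_0:
  assumes T: "endo T" and T': "endo T'" and cnj: "\<And>c v. v \<in> gen_eig T c \<Longrightarrow> T' v = cnj c *s v"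
    and tr: "trace (\<lambda>x. T (T' x)) = 0"
  shows "\<exists>n. (T ^^ n) v = 0"
proof -
  obtain B l where B: "independent B" "span B = UNIV"
    and l: "\<And>b. b \<in> B \<Longrightarrow> b \<in> gen_eig T (l b)" "\<And>b. b \<in> B \<Longrightarrow> representation B (T b) b = l b"
    using triangular_basis[OF T] by blast
  have "representation B (T (T' b)) b = of_real ((cmod (l b))\<^sup>2)" if "b \<in> B" for b
    using that B l by (simp add: cnj[OF l(1)] endo_scale[OF T] representation_scale
        complex_norm_square mult.commute del: of_real_power)
  then have "trace (\<lambda>x. T (T' x)) = (\<Sum>b\<in>B. of_real ((cmod (l b))\<^sup>2))"
    unfolding trace_basis[OF B endo_comp[OF T T']] by (rule sum.cong[OF refl])
  then have "complex_of_real (\<Sum>b\<in>B. (cmod (l b))\<^sup>2) = 0" using tr by simp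
  then have "(\<Sum>b\<in>B. (cmod (l b))\<^sup>2) = 0" by (simp only: of_real_eq_0_iff)
  then have "l b = 0" if "b \<in> B" for b
    using that finiteI_independent[OF B(1)] by (simp add: sum_nonneg_eq_0_iff)
  then have "B \<subseteq> gen_eig T 0" using l(1) by fastforce
  then have "gen_eig T 0 = UNIV" using span_minimal[OF _ subspace_gen_eig[OF T]] B(2) by blast
  then show ?thesis unfolding gen_eig_def by (simp add: set_eq_iff)
qed

end

section \<open>Lie algebras\<close>

locale complex_lie_algebra = lie_algebra scale br + complex_fd_space scale Basis
  for scale :: "complex \<Rightarrow> 'a::ab_group_add \<Rightarrow> 'a" (infixr "*s" 75) and br and Basis
begin

lemma endo_br: "endo (br x)" and endo_br_left: "endo (\<lambda>x. br x y)"
  using bilinear_br unfolding bilinear_on_space_def by (auto simp: eta_contract_eq)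

lemmas br_simps = endo_simps[OF endo_br] endo_simps[OF endo_br_left]

lemma br_skew: "br x y = - br y x"
proof -
  have "br (x + y) (x + y) = br x y + br y x"
    unfolding endo_add[OF endo_br] endo_add[OF endo_br_left] by (simp add: alternating)
  then have "br x y + br y x = 0" by (simp only: alternating)
  then show ?thesis by (simp add: eq_neg_iff_add_eq_0)
qed

lemma br_leibniz: "br x (br y z) = br (br x y) z + br y (br x z)"
  using jacobi[of x y z] br_skew[of z x] br_skew[of z "br x y"]
  by (simp add: br_simps algebra_simps add_eq_0_iff2)

section \<open>Derivations and their generalized eigenspaces\<close>

definition derivation :: "('a \<Rightarrow> 'a) \<Rightarrow> bool" where
  "derivation D \<longleftrightarrow> endo D \<and> (\<forall>x y. D (br x y) = br (D x) y + br x (D y))"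

lemma derivation_endo: "derivation D \<Longrightarrow> endo D"
  and derivation_br: "derivation D \<Longrightarrow> D (br x y) = br (D x) y + br x (D y)"
  unfolding derivation_def by blast+

lemma derivation_ad: "derivation (br x)"
  unfolding derivation_def using endo_br br_leibniz by blast

text \<open>\<open>D - (c + d)\<close> sends \<open>br u v\<close> to
  \<open>br ((D - c) u) v + br u ((D - d) v)\<close>, and a double induction on the two exponents
  covers both terms.\<close>

lemma gen_eig_br:
  assumes D: "derivation D" and u: "u \<in> gen_eig D c" and v: "v \<in> gen_eig D d"
  shows "br u v \<in> gen_eig D (c + d)"
proof -
  note E = derivation_endo[OF D]
  have "0 \<in> gen_eig D (c + d)" by (rule subspace_0[OF subspace_gen_eig[OF E]])
  have "\<forall>v\<in>gen_eig D d. br u v \<in> gen_eig D (c + d)"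
    using E u
  proof (induction rule: gen_eig_induct)
    case zero
    show ?case using \<open>0 \<in> gen_eig D (c + d)\<close> by (simp add: br_simps)
  next
    case (step u)
    show ?case
    proof
      fix v assume "v \<in> gen_eig D d"
      with E show "br u v \<in> gen_eig D (c + d)"
      proof (induction rule: gen_eig_induct)
        case zero
        show ?case using \<open>0 \<in> gen_eig D (c + d)\<close> by (simp add: br_simps)
      next
        case (step v)
        have "D (br u v) - (c + d) *s br u v = br (D u - c *s u) v + br u (D v - d *s v)"
          by (simp add: derivation_br[OF D] br_simps scale_left_distrib)
        moreover have "\<dots> \<in> gen_eig D (c + d)"
          using step \<open>\<forall>v\<in>gen_eig D d. br (D u - c *s u) v \<in> gen_eig D (c + d)\<close>
          by (intro subspace_add[OF subspace_gen_eig[OF E]]) auto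
        ultimately show ?case by (simp only: gen_eig_shiftD[of D "br u v"])
      qed
    qed
  qed
  with v show ?thesis by blast
qed

text \<open>As \<open>br u v\<close> belongs to the eigenvalue \<open>c + d\<close>, the Leibniz
  rule on generalized eigenvectors is the additivity of \<open>f\<close>; bilinearity does the rest.
  The intended \<open>f\<close> is \<open>cnj\<close>.\<close>

lemma derivation_multiplier:
  assumes D: "derivation D" and T: "endo T"
    and f: "\<And>c d. f (c + d) = f c + f d" "\<And>c v. v \<in> gen_eig D c \<Longrightarrow> T v = f c *s v"
  shows "derivation T"
proof -
  let ?G = "\<Union>c. gen_eig D c"
  have span: "x \<in> span ?G" for x using span_gen_eig[OF derivation_endo[OF D]] by simp
  have hom: "T (br u v) = br (T u) v + br u (T v)" if uv: "u \<in> ?G" "v \<in> ?G" for u v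
  proof -
    from uv obtain c d where c: "u \<in> gen_eig D c" "v \<in> gen_eig D d" by blast
    then show ?thesis
      by (simp add: f(2)[OF gen_eig_br[OF D c]] f(2)[OF c(1)] f(2)[OF c(2)] f(1) br_simps scale_left_distrib)
  qed
  have right: "T (br u v) = br (T u) v + br u (T v)" if "u \<in> ?G" for u v
    using span[of v]
  proof (induction rule: span_induct_alt)
    case base
    show ?case by (simp add: br_simps endo_simps[OF T])
  next
    case (step c x y)
    then show ?case using hom[OF that, of x]
      by (simp add: br_simps endo_simps[OF T] scale_right_distrib algebra_simps)
  qed
  have "T (br u v) = br (T u) v + br u (T v)" for u v
    using span[of u]
  proof (induction rule: span_induct_alt)
    case base
    show ?case by (simp add: br_simps endo_simps[OF T])
  next
    case (step c x y)
    then show ?case using right[of x]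
      by (simp add: br_simps endo_simps[OF T] scale_right_distrib algebra_simps)
  qed
  with T show ?thesis unfolding derivation_def by blast
qed

section \<open>The Killing form\<close>

definition killing :: "'a \<Rightarrow> 'a \<Rightarrow> complex" where
  "killing x y = trace (\<lambda>z. br x (br y z))"

lemma killing_sym: "killing x y = killing y x"
  unfolding killing_def by (rule trace_commute[OF endo_br endo_br])

lemma killing_add_left: "killing (x + y) z = killing x z + killing y z"
  by (simp add: killing_def br_simps trace_add)

lemma killing_scale_left: "killing (c *s x) z = c * killing x z"
  by (simp add: killing_def br_simps trace_scale)

lemma killing_zero_left: "killing 0 z = 0"
  by (simp add: killing_def br_simps trace_zero)

text \<open>\<open>br (D x)\<close> is the commutator of \<open>D\<close> with \<open>br x\<close>,
  so \<open>killing (D x) y + killing x (D y)\<close> is the trace of a commutator. For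
  \<open>D = br z\<close> this is invariance; it is also applied to left multiplications of the
  post-Lie product.\<close>

lemma killing_derivation:
  assumes D: "derivation D"
  shows "killing (D x) y = - killing x (D y)"
proof -
  have 1: "br (D x) w = D (br x w) - br x (D w)" for x w
    by (simp add: derivation_br[OF D])
  have "killing (D x) y = trace (\<lambda>z. D (br x (br y z))) - trace (\<lambda>z. br x (D (br y z)))"
    unfolding killing_def 1 trace_diff ..
  moreover have "killing x (D y) = trace (\<lambda>z. br x (D (br y z))) - trace (\<lambda>z. br x (br y (D z)))"
    unfolding killing_def 1 by (simp only: br_simps trace_diff)
  moreover have "trace (\<lambda>z. D (br x (br y z))) = trace (\<lambda>z. br x (br y (D z)))"
    using trace_commute[OF derivation_endo[OF D] endo_comp[OF endo_br endo_br]] .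
  ultimately show ?thesis by simp
qed

definition killing_radical :: "'a set" where
  "killing_radical = {x. \<forall>y. killing x y = 0}"

lemma ideal_killing_radical: "ideal_of killing_radical UNIV"
  unfolding ideal_of_def
proof (intro conjI ballI)
  show "subspace killing_radical"
    unfolding killing_radical_def
    by (rule subspaceI) (auto simp: killing_add_left killing_scale_left killing_zero_left)
  show "br x y \<in> killing_radical" if "y \<in> killing_radical" for x y
    using that killing_derivation[OF derivation_ad] unfolding killing_radical_def by simp
qed simp

section \<open>The derived ideal of the Killing radical\<close>

lemma bracket_in: "x \<in> U \<Longrightarrow> y \<in> V \<Longrightarrow> br x y \<in> bracket_space U V"
  unfolding bracket_space_def by (rule span_base) blast

lemma bracket_space_minimal:
  "(\<And>x y. x \<in> U \<Longrightarrow> y \<in> V \<Longrightarrow> br x y \<in> W) \<Longrightarrow> subspace W \<Longrightarrow> bracket_space U V \<subseteq> W"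
  unfolding bracket_space_def by (rule span_minimal) auto

lemma subspace_bracket_space: "subspace (bracket_space U V)"
  unfolding bracket_space_def by (rule subspace_span)

lemma ideal_bracket_space:
  assumes "ideal_of I UNIV"
  shows "ideal_of (bracket_space I I) UNIV"
proof -
  have "bracket_space I I \<subseteq> {y. br x y \<in> bracket_space I I}" for x
  proof (rule bracket_space_minimal)
    show "subspace {y. br x y \<in> bracket_space I I}"
      using subspace_bracket_space by (rule module_hom.subspace_linear_preimage[OF endo_hom[OF endo_br]])
    fix a b assume "a \<in> I" "b \<in> I"
    then show "br a b \<in> {y. br x y \<in> bracket_space I I}"
      using assms unfolding ideal_of_def
      by (auto simp: br_leibniz[of x a b] intro!: subspace_add[OF subspace_bracket_space] bracket_in)
  qed
  then show ?thesis unfolding ideal_of_def using subspace_bracket_space by blast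
qed

text \<open>For \<open>w = br a b\<close>, cyclicity of the trace and the Leibniz rule for
  \<open>T\<close> turn the trace into \<open>- killing a (T b)\<close>, which vanishes for
  \<open>a\<close> in the radical, whether \<open>T\<close> is inner or not.\<close>

lemma trace_derived_killing_radical:
  assumes T: "derivation T" and w: "w \<in> bracket_space killing_radical killing_radical"
  shows "trace (\<lambda>z. br w (T z)) = 0"
proof -
  have "bracket_space killing_radical killing_radical \<subseteq> {w. trace (\<lambda>z. br w (T z)) = 0}"
  proof (rule bracket_space_minimal)
    show "subspace {w. trace (\<lambda>z. br w (T z)) = 0}"
      by (rule subspaceI) (simp_all add: br_simps trace_add trace_scale trace_zero)
    fix a b assume a: "a \<in> killing_radical"
    have "br (br a b) (T z) = br a (br b (T z)) - br b (br a (T z))" for z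
      using br_leibniz[of a b "T z"] by simp
    then have "trace (\<lambda>z. br (br a b) (T z))
        = trace (\<lambda>z. br a (br b (T z))) - trace (\<lambda>z. br b (br a (T z)))"
      by (simp add: trace_diff)
    also have "trace (\<lambda>z. br b (br a (T z))) = trace (\<lambda>z. br a (T (br b z)))"
      using trace_commute[OF endo_br[of b] endo_comp[OF endo_br[of a] derivation_endo[OF T]]] .
    also have "trace (\<lambda>z. br a (T (br b z))) = killing a (T b) + trace (\<lambda>z. br a (br b (T z)))"
      by (simp add: derivation_br[OF T] br_simps trace_add killing_def)
    finally show "br a b \<in> {w. trace (\<lambda>z. br w (T z)) = 0}"
      using a unfolding killing_radical_def by simp
  qed
  with w show ?thesis by blast
qed

text \<open>The step of Cartan's criterion that needs the Jordan decomposition: the map acting as \<open>cnj c\<close> on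
  the \<open>c\<close>-generalized eigenspace of \<open>br u\<close> is itself a derivation, though not an inner one in general.\<close>

lemma ad_nilpotent_derived_killing_radical:
  assumes "u \<in> bracket_space killing_radical killing_radical"
  shows "\<exists>n. (br u ^^ n) v = 0"
proof -
  obtain T where T: "endo T" "\<And>c v. v \<in> gen_eig (br u) c \<Longrightarrow> T v = cnj c *s v"
    using gen_eig_multiplier[OF endo_br] by blast
  have "derivation T" by (rule derivation_multiplier[OF derivation_ad T(1) _ T(2)]) simp_all
  then have "trace (\<lambda>z. br u (T z)) = 0" using assms by (rule trace_derived_killing_radical)
  with endo_br T show ?thesis by (rule nilpotent_if_trace_cnj_part_eq_0)
qed

section \<open>Engel's theorem\<close>

definition stable :: "'a set \<Rightarrow> 'a set \<Rightarrow> bool" where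
  "stable K U \<longleftrightarrow> subspace U \<and> (\<forall>k\<in>K. \<forall>u\<in>U. br k u \<in> U)"

text \<open>The conclusion of Engel's theorem, for all subquotients of the adjoint module at once.\<close>

definition engel :: "'a set \<Rightarrow> bool" where
  "engel K \<longleftrightarrow> (\<forall>U W. stable K U \<and> stable K W \<and> W \<subset> U \<longrightarrow>
     (\<exists>v\<in>U - W. \<forall>k\<in>K. br k v \<in> W))"

lemma engelE:
  assumes "engel K" "stable K U" "stable K W" "W \<subset> U"
  obtains v where "v \<in> U" "v \<notin> W" "\<And>k. k \<in> K \<Longrightarrow> br k v \<in> W"
proof -
  have "\<exists>v\<in>U - W. \<forall>k\<in>K. br k v \<in> W" using assms unfolding engel_def by simp
  then show ?thesis using that by blast
qed

lemma in_span_insert_subspace: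
  "subspace K \<Longrightarrow> y \<in> span (insert x K) \<longleftrightarrow> (\<exists>c. y - c *s x \<in> K)"
  by (simp add: span_insert span_eq_iff[THEN iffD2])

text \<open>Let \<open>N\<close> consist of the vectors of \<open>U\<close> that \<open>K\<close>
  maps into \<open>W\<close>. As \<open>x\<close> normalizes \<open>K\<close>, \<open>br x\<close>
  preserves \<open>N\<close>; as \<open>br x\<close> is nilpotent, it maps some vector of
  \<open>N\<close> outside \<open>W\<close> into \<open>W\<close>.\<close>

lemma engel_insert:
  assumes K: "subalgebra K" "engel K" and x: "\<And>k. k \<in> K \<Longrightarrow> br k x \<in> K"
    and nil: "\<And>v. \<exists>n. (br x ^^ n) v = 0"
  shows "engel (span (insert x K))"
  unfolding engel_def
proof (intro allI impI, elim conjE)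
  fix U W assume st: "stable (span (insert x K)) U" "stable (span (insert x K)) W" "W \<subset> U"
  have subK: "subspace K" using K(1) unfolding subalgebra_def by blast
  have KU: "stable K U" "stable K W" and xU: "\<And>u. u \<in> U \<Longrightarrow> br x u \<in> U" "\<And>u. u \<in> W \<Longrightarrow> br x u \<in> W"
    using st span_base[of _ "insert x K"] unfolding stable_def by blast+
  then have W: "subspace W" unfolding stable_def by blast
  define N where "N = {v \<in> U. \<forall>k\<in>K. br k v \<in> W}"
  obtain v where "v \<in> U" "v \<notin> W" "\<And>k. k \<in> K \<Longrightarrow> br k v \<in> W"
    using engelE[OF K(2) KU st(3)] by metis
  then have v: "v \<in> N" "v \<notin> W" unfolding N_def by blast+
  have xN: "br x v \<in> N" if v: "v \<in> N" for v
  proof -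
    have "br k (br x v) \<in> W" if "k \<in> K" for k
      unfolding br_leibniz[of k x v] using v x[OF that] xU(2) that unfolding N_def
      by (intro subspace_add[OF W]) blast+
    then show ?thesis using v xU(1) unfolding N_def by blast
  qed
  obtain n where "(br x ^^ n) v = 0" using nil by blast
  then have "(br x ^^ n) v \<in> W" using subspace_0[OF W] by simp
  with v have "\<exists>u\<in>N. u \<notin> W \<and> br x u \<in> W"
  proof (induction n arbitrary: v)
    case 0
    then show ?case by simp
  next
    case (Suc n)
    then have "(br x ^^ n) (br x v) \<in> W" by (simp add: funpow_Suc_right del: funpow.simps)
    then show ?case using Suc.IH[of "br x v"] Suc.prems xN by blast
  qed
  then obtain u where u: "u \<in> N" "u \<notin> W" "br x u \<in> W" by blast
  have "br k u \<in> W" if k: "k \<in> span (insert x K)" for k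
  proof -
    obtain c where "k - c *s x \<in> K" using k in_span_insert_subspace[OF subK] by blast
    then have "br (k - c *s x) u \<in> W" using u unfolding N_def by blast
    then have "br (k - c *s x) u + c *s br x u \<in> W" using u(3) subspace_add[OF W] subspace_scale[OF W] by blast
    then show ?thesis by (simp add: br_simps)
  qed
  then show "\<exists>v\<in>U - W. \<forall>k\<in>span (insert x K). br k v \<in> W" using u unfolding N_def by blast
qed

lemma maximal_dim:
  assumes "P W0"
  obtains W where "P W" "\<And>W'. P W' \<Longrightarrow> dim W' \<le> dim W"
proof -
  have "\<forall>W. P W \<longrightarrow> dim W < Suc dimension" by (intro allI impI le_imp_less_Suc dim_subset_UNIV)
  then have "\<exists>W. P W \<and> (\<forall>W'. P W' \<longrightarrow> dim W' \<le> dim W)"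
    by (rule ex_has_greatest_nat[of P W0 dim, OF assms])
  then show ?thesis using that by blast
qed

lemma dim_span_insert:
  assumes "subspace K" "x \<notin> K"
  shows "dim K < dim (span (insert x K))"
proof (rule dim_psubset)
  have "x \<in> span (insert x K)" by (rule span_base) simp
  moreover have "x \<notin> span K" using assms by (simp add: span_eq_iff[THEN iffD2])
  ultimately show "span K \<subset> span (span (insert x K))"
    unfolding span_span using span_mono[of K "insert x K"] by blast
qed

text \<open>Take a subalgebra \<open>K\<close> of \<open>J\<close> of largest dimension with
  \<open>engel K\<close>. If it were proper, \<open>engel K\<close> applied to \<open>J\<close>
  modulo \<open>K\<close> would give an \<open>x\<close> normalizing \<open>K\<close>, and
  \<open>engel_insert\<close> would enlarge \<open>K\<close>.\<close>

theorem engel_if_ad_nilpotent: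
  assumes J: "subalgebra J" and nil: "\<And>x v. x \<in> J \<Longrightarrow> \<exists>n. (br x ^^ n) v = 0"
  shows "engel J"
proof -
  define P where "P K \<longleftrightarrow> subalgebra K \<and> K \<subseteq> J \<and> engel K" for K
  have subJ: "subspace J" using J unfolding subalgebra_def by blast
  have "P {0}"
    unfolding P_def subalgebra_def engel_def stable_def
    using subspace_0[OF subJ] subspace_0 by (auto simp: br_simps)
  then obtain K where K: "P K" and max: "\<And>K'. P K' \<Longrightarrow> dim K' \<le> dim K"
    by (rule maximal_dim) blast
  have alg: "subalgebra K" "K \<subseteq> J" "engel K" using K unfolding P_def by blast+
  then have subK: "subspace K" unfolding subalgebra_def by blast
  have "K = J"
  proof (rule ccontr)
    assume "K \<noteq> J"
    then have "K \<subset> J" using alg by blast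
    moreover have "stable K J" "stable K K" using J alg unfolding stable_def subalgebra_def by blast+
    ultimately obtain x where x: "x \<in> J" "x \<notin> K" "\<And>k. k \<in> K \<Longrightarrow> br k x \<in> K"
      using alg(3) engelE by metis
    let ?K = "span (insert x K)"
    have "br y z \<in> K" if yz: "y \<in> ?K" "z \<in> ?K" for y z
    proof -
      obtain c d where cd: "y - c *s x \<in> K" "z - d *s x \<in> K"
        using yz in_span_insert_subspace[OF subK] by metis
      \<comment> \<open>Reduce \<open>y\<close> and \<open>z\<close> modulo \<open>x\<close>: the
        \<open>br x x\<close> term vanishes and each term on the right lies in
        \<open>K\<close>.\<close>
      have "br y z = br (y - c *s x) (z - d *s x) + d *s br (y - c *s x) x - c *s br (z - d *s x) x"
        using br_skew[of x z]
        by (simp add: br_simps alternating scale_right_diff_distrib algebra_simps)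
      also have "\<dots> \<in> K"
        using cd x(3) alg(1) subspace_scale[OF subK] unfolding subalgebra_def
        by (intro subspace_diff[OF subK] subspace_add[OF subK]) blast+
      finally show ?thesis .
    qed
    then have "subalgebra ?K"
      unfolding subalgebra_def using span_base[of _ "insert x K"] by blast
    moreover have "?K \<subseteq> J" using x(1) alg(2) subJ by (intro span_minimal) auto
    moreover have "engel ?K" using alg(1,3) x(3) nil[OF x(1)] by (rule engel_insert)
    ultimately have "dim ?K \<le> dim K" using max unfolding P_def by blast
    then show False using dim_span_insert[OF subK x(2)] by simp
  qed
  then show ?thesis using alg by simp
qed

section \<open>Solvability and Cartan's criterion\<close>

lemma derived_series_shift: "derived_series L (Suc n) = derived_series (bracket_space L L) n"
  by (induction n) simp_all

lemma bracket_space_mono: "U \<subseteq> U' \<Longrightarrow> V \<subseteq> V' \<Longrightarrow> bracket_space U V \<subseteq> bracket_space U' V'"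
  unfolding bracket_space_def by (rule span_mono) blast

lemma derived_series_mono: "L \<subseteq> M \<Longrightarrow> derived_series L n \<subseteq> derived_series M n"
  by (induction n) (simp_all add: bracket_space_mono)

text \<open>The derived series of \<open>L\<close>, shifted by one, stays inside that of
  \<open>M\<close>.\<close>

lemma solvable_if_bracket_subset:
  assumes "bracket_space L L \<subseteq> M" "solvable M"
  shows "solvable L"
proof -
  obtain n where "derived_series M n = {0}" using assms(2) unfolding solvable_def by blast
  then have "derived_series L (Suc n) \<subseteq> {0}"
    using derived_series_mono[OF assms(1), of n] unfolding derived_series_shift by simp
  moreover have "0 \<in> derived_series L (Suc n)" by (simp add: subspace_0 subspace_bracket_space)
  ultimately show ?thesis unfolding solvable_def by blast
qed

text \<open>Let \<open>W\<close> be a solvable \<open>J\<close>-stable subspace of \<open>J\<close>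
  of largest dimension. If \<open>W\<close> were proper, \<open>engel\<close> would give an
  \<open>x\<close> outside \<open>W\<close> that \<open>J\<close> brackets into \<open>W\<close>;
  adjoining \<open>x\<close> keeps all brackets in \<open>W\<close>, hence keeps
  solvability.\<close>

lemma solvable_if_engel:
  assumes J: "subalgebra J" "engel J"
  shows "solvable J"
proof -
  define P where "P W \<longleftrightarrow> stable J W \<and> W \<subseteq> J \<and> solvable W" for W
  have subJ: "subspace J" using J unfolding subalgebra_def by blast
  have "solvable {0}" unfolding solvable_def by (rule exI[of _ 0]) simp
  then have "P {0}" unfolding P_def stable_def using subspace_0[OF subJ] by (auto simp: br_simps)
  then obtain W where W: "P W" and max: "\<And>W'. P W' \<Longrightarrow> dim W' \<le> dim W"
    by (rule maximal_dim) blast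
  have st: "stable J W" "W \<subseteq> J" "solvable W" and subW: "subspace W"
    using W unfolding P_def stable_def by blast+
  have "W = J"
  proof (rule ccontr)
    assume "W \<noteq> J"
    then have "W \<subset> J" using st by blast
    moreover have "stable J J" using J unfolding stable_def subalgebra_def by blast
    ultimately obtain x where x: "x \<in> J" "x \<notin> W" "\<And>k. k \<in> J \<Longrightarrow> br k x \<in> W"
      using J(2) st(1) engelE by metis
    let ?W = "span (insert x W)"
    have sub: "?W \<subseteq> J" using x(1) st(2) subJ by (intro span_minimal) auto
    have JW: "br y z \<in> W" if yz: "y \<in> J" "z \<in> ?W" for y z
    proof -
      obtain c where c: "z - c *s x \<in> W" using yz in_span_insert_subspace[OF subW] by blast
      then have "br y (z - c *s x) + c *s br y x \<in> W"
        using yz x(3) st(1) subspace_scale[OF subW] unfolding stable_def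
        by (intro subspace_add[OF subW]) blast+
      then show ?thesis by (simp add: br_simps)
    qed
    then have "stable J ?W"
      unfolding stable_def using span_base[of _ "insert x W"] by blast
    moreover have "solvable ?W"
      using JW sub by (intro solvable_if_bracket_subset[OF bracket_space_minimal st(3)] subW) auto
    ultimately have "dim ?W \<le> dim W" using max sub unfolding P_def by blast
    then show False using dim_span_insert[OF subW x(2)] by simp
  qed
  then show ?thesis using st by simp
qed

text \<open>The elements of the derived ideal are ad-nilpotent, so Engel's theorem makes that ideal
  solvable, and with it the radical.\<close>

lemma solvable_killing_radical: "solvable killing_radical"
proof (rule solvable_if_bracket_subset[OF order_refl], rule solvable_if_engel)
  show "subalgebra (bracket_space killing_radical killing_radical)"
    using ideal_bracket_space[OF ideal_killing_radical] unfolding ideal_of_def subalgebra_def by blast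
  then show "engel (bracket_space killing_radical killing_radical)"
    by (rule engel_if_ad_nilpotent) (rule ad_nilpotent_derived_killing_radical)
qed

section \<open>Schur's lemma and homomorphisms of irreducible modules\<close>

text \<open>Over the complex numbers \<open>f\<close> has an eigenvector in \<open>V\<close>. The
  corresponding eigenspace in \<open>V\<close> is a nonzero submodule, hence all of
  \<open>V\<close>.\<close>

lemma schur:
  assumes V: "irreducible_module S V" and f: "endo f" and fV: "\<And>v. v \<in> V \<Longrightarrow> f v \<in> V"
    and comm: "\<And>s v. s \<in> S \<Longrightarrow> v \<in> V \<Longrightarrow> f (br s v) = br s (f v)"
  obtains c where "\<And>v. v \<in> V \<Longrightarrow> f v = c *s v"
proof -
  have mod: "lie_module S V" "V \<noteq> {0}" using V unfolding irreducible_module_def by blast+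
  then have sub: "subspace V" unfolding lie_module_def by blast
  obtain v where v: "v \<in> V" "v \<notin> {0}" using mod subspace_0[OF sub] by blast
  obtain u c where u: "u \<in> V" "u \<notin> {0}" "f u - c *s u \<in> {0}"
    by (rule quotient_eigenvector[OF f subspace_single_0 sub _ fV v]) (auto simp: endo_zero[OF f])
  let ?W = "{v \<in> V. f v = c *s v}"
  have "lie_module S ?W"
    unfolding lie_module_def
  proof (intro conjI ballI)
    show "subspace ?W"
      by (rule subspaceI)
        (auto simp: subspace_0[OF sub] subspace_add[OF sub] subspace_scale[OF sub] endo_simps[OF f]
          scale_right_distrib scale_left_commute simp del: scale_scale)
    show "br s v \<in> ?W" if "s \<in> S" "v \<in> ?W" for s v
      using that mod(1) comm[of s v] unfolding lie_module_def by (simp add: br_simps)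
  qed
  moreover have "?W \<noteq> {0}" using u by (metis (mono_tags, lifting) eq_iff_diff_eq_0 mem_Collect_eq singletonD)
  moreover have "?W \<subseteq> V" by blast
  ultimately have "?W = V" using V unfolding irreducible_module_def by blast
  then show ?thesis using that by blast
qed

text \<open>Kernel and image of \<open>g\<close> are submodules. Linearity is required on
  \<open>V\<close> only, because \<open>g\<close> will be built from \<open>component\<close>, whose
  linearity is known only on the sum of the family.\<close>

lemma irreducible_hom_zero_or_iso:
  assumes V: "irreducible_module S V" and W: "irreducible_module S W"
    and g: "\<And>v. v \<in> V \<Longrightarrow> g v \<in> W" "\<And>u v. u \<in> V \<Longrightarrow> v \<in> V \<Longrightarrow> g (u + v) = g u + g v"
      "\<And>c v. v \<in> V \<Longrightarrow> g (c *s v) = c *s g v" "\<And>s v. s \<in> S \<Longrightarrow> v \<in> V \<Longrightarrow> g (br s v) = br s (g v)"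
  shows "(\<forall>v\<in>V. g v = 0) \<or> module_iso S V W g"
proof -
  have mod: "lie_module S V" "V \<noteq> {0}" using V unfolding irreducible_module_def by blast+
  then have subV: "subspace V" unfolding lie_module_def by blast
  have brV: "br s v \<in> V" if "s \<in> S" "v \<in> V" for s v using mod(1) that unfolding lie_module_def by blast
  note sub = subspace_0[OF subV] subspace_add[OF subV] subspace_scale[OF subV]
  have g0: "g 0 = 0" using g(3)[OF sub(1), of 0] by simp
  let ?K = "{v \<in> V. g v = 0}"
  have "lie_module S ?K"
    unfolding lie_module_def
  proof (intro conjI ballI)
    show "subspace ?K" by (rule subspaceI) (simp_all add: sub g0 g)
    show "br s v \<in> ?K" if "s \<in> S" "v \<in> ?K" for s v
      using that g(4)[of s v] brV by (simp add: br_simps)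
  qed
  then consider "?K = V" | "?K = {0}" using V unfolding irreducible_module_def by blast
  then show ?thesis
  proof cases
    case 1
    then show ?thesis by blast
  next
    case 2
    have "lie_module S (g ` V)"
      unfolding lie_module_def
    proof (intro conjI ballI)
      show "subspace (g ` V)"
      proof (rule subspaceI)
        show "0 \<in> g ` V" using sub(1) g0 by force
      next
        fix x y assume "x \<in> g ` V" "y \<in> g ` V"
        then show "x + y \<in> g ` V" using g(2) sub(2) by (metis (no_types, lifting) imageE imageI)
      next
        fix c x assume "x \<in> g ` V"
        then show "c *s x \<in> g ` V" using g(3) sub(3) by (metis (no_types, lifting) imageE imageI)
      qed
      show "br s x \<in> g ` V" if "s \<in> S" "x \<in> g ` V" for s x
        using that g(4) brV by (metis (no_types, lifting) imageE imageI)
    qed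
    moreover have "g ` V \<subseteq> W" using g(1) by blast
    moreover have "g ` V \<noteq> {0}"
    proof
      assume "g ` V = {0}"
      then have "V \<subseteq> ?K" by blast
      with 2 mod(2) sub(1) show False by blast
    qed
    ultimately have "g ` V = W" using W unfolding irreducible_module_def by blast
    moreover have "inj_on g V"
    proof (rule inj_onI)
      fix x y assume xy: "x \<in> V" "y \<in> V" "g x = g y"
      \<comment> \<open>The difference takes this form because \<open>g\<close> is only known to
        respect sums and scalars.\<close>
      have "g (x + (- 1) *s y) = 0" using xy by (simp only: g(2) g(3) sub) simp
      then have "x - y \<in> ?K" using xy subspace_diff[OF subV] by simp
      then show "x = y" using 2 by simp
    qed
    ultimately show ?thesis unfolding module_iso_def bij_betw_def using g by blast
  qed
qed

text \<open>For \<open>j \<noteq> i\<close> the component of \<open>f\<close> from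
  \<open>V i\<close> to \<open>V j\<close> is a homomorphism between non-isomorphic irreducible
  modules, hence zero.\<close>

lemma endo_preserves_summand:
  assumes dir: "direct_family I V" and f: "endo f"
    and irr: "\<And>i. i \<in> I \<Longrightarrow> irreducible_module S (V i)"
    and noniso: "\<And>i j. i \<in> I \<Longrightarrow> j \<in> I \<Longrightarrow> i \<noteq> j \<Longrightarrow> \<not> isomorphic_modules S (V i) (V j)"
    and fA: "\<And>x. x \<in> family_sum I V \<Longrightarrow> f x \<in> family_sum I V"
    and comm: "\<And>s x. s \<in> S \<Longrightarrow> x \<in> family_sum I V \<Longrightarrow> f (br s x) = br s (f x)"
    and i: "i \<in> I" and v: "v \<in> V i"
  shows "f v \<in> V i"
proof -
  have ViA: "x \<in> family_sum I V" if "x \<in> V i" for x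
    using dir that i unfolding direct_family_def by (intro family_sum_single) auto
  have brV: "br s x \<in> V j" if "j \<in> I" "s \<in> S" "x \<in> V j" for s j x
    using irr that unfolding irreducible_module_def lie_module_def by blast
  have zero: "component I V (f v) j = 0" if j: "j \<in> I" "j \<noteq> i" for j
  proof -
    let ?g = "\<lambda>x. component I V (f x) j"
    have "(\<forall>x\<in>V i. ?g x = 0) \<or> module_iso S (V i) (V j) ?g"
    proof (rule irreducible_hom_zero_or_iso[OF irr[OF i] irr[OF j(1)]])
      show "?g x \<in> V j" if "x \<in> V i" for x using component_in[OF fA[OF ViA[OF that]] j(1)] .
      show "?g (x + y) = ?g x + ?g y" if "x \<in> V i" "y \<in> V i" for x y
        using component_add[OF dir _ _ j(1)] fA ViA that by (simp add: endo_simps[OF f])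
      show "?g (c *s x) = c *s ?g x" if "x \<in> V i" for c x
        using component_scale[OF dir _ j(1)] fA ViA that by (simp add: endo_simps[OF f])
      show "?g (br s x) = br s (?g x)" if "s \<in> S" "x \<in> V i" for s x
        using component_map[OF dir fA[OF ViA[OF that(2)]] j(1) endo_br brV[OF _ that(1)]]
          comm[OF that(1) ViA[OF that(2)]] by simp
    qed
    then show ?thesis using v noniso[OF i j(1)] j(2) unfolding isomorphic_modules_def by blast
  qed
  have "f v = (\<Sum>j\<in>I. component I V (f v) j)" using sum_component[OF fA[OF ViA[OF v]]] by simp
  also have "\<dots> = (\<Sum>j\<in>I. if j = i then component I V (f v) i else 0)"
    using zero by (intro sum.cong) auto
  also have "\<dots> = component I V (f v) i" using dir i unfolding direct_family_def by simp
  finally show ?thesis using component_in[OF fA[OF ViA[OF v]] i] by simp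
qed

lemma direct_family_if_direct_sum_of:
  assumes "direct_sum_of A n V" "\<And>i. i < n \<Longrightarrow> subspace (V i)"
  shows "direct_family {..<n} V" "A = family_sum {..<n} V"
  using assms unfolding direct_sum_of_def direct_family_def family_sum_def by (simp_all add: Ball_def)

section \<open>Commutative post-Lie structures\<close>

theorem commutative_post_lie_trivial:
  assumes perfect: "perfect"
    and A: "solvable_radical_of A UNIV" "abelian A"
    and sum: "direct_sum_of A n V" and irr: "\<And>i. i < n \<Longrightarrow> irreducible_module S (V i)"
    and noniso: "\<And>i j. i < n \<Longrightarrow> j < n \<Longrightarrow> i \<noteq> j \<Longrightarrow> \<not> isomorphic_modules S (V i) (V j)"
    and p: "commutative_post_lie p"
  shows "p x y = 0"
proof -
  have endo: "endo (p x)" "endo (\<lambda>x. p x y)" for x y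
    using p unfolding commutative_post_lie_def bilinear_on_space_def by (auto simp: eta_contract_eq)
  have comm: "p x y = p y x"
    and hom: "p (br x y) z = p x (p y z) - p y (p x z)"
    and der: "p x (br y z) = br (p x y) z + br y (p x z)" for x y z
    using p unfolding commutative_post_lie_def by blast+
  have D: "derivation (p x)" for x unfolding derivation_def using endo der by blast
  have "killing (p x y) z = 0" for x y z
  proof -
    \<comment> \<open>A trilinear form that is symmetric in its first two and alternating in its last two
      arguments vanishes.\<close>
    have swap: "killing (p x y) z = - killing (p x z) y" for x y z
      using killing_derivation[OF D, of x y z] by (simp add: killing_sym[of y])
    have "killing (p x y) z = - killing (p z x) y" using swap[of x y z] comm[of x z] by simp
    also have "\<dots> = killing (p y z) x" using swap[of z x y] comm[of z y] by simp
    also have "\<dots> = - killing (p x y) z" using swap[of y z x] comm[of y x] by simp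
    finally show ?thesis by (simp add: equal_neg_zero)
  qed
  then have "p x y \<in> killing_radical" for x y unfolding killing_radical_def by blast
  then have pA: "p x y \<in> A" for x y
    using A(1) ideal_killing_radical solvable_killing_radical unfolding solvable_radical_of_def by blast
  have idA: "br x a \<in> A" if "a \<in> A" for x a
    using A(1) that unfolding solvable_radical_of_def ideal_of_def by blast
  \<comment> \<open>In the derivation rule the term \<open>br (p x y) a\<close> drops out, since
    both arguments lie in the abelian \<open>A\<close>.\<close>
  have pbr: "p x (br y a) = br y (p x a)" if "a \<in> A" for x y a
    using A(2) pA that unfolding der abelian_def by simp
  have sub: "subspace (V i)" if "i < n" for i
    using irr[OF that] unfolding irreducible_module_def lie_module_def by blast
  have dir: "direct_family {..<n} V" "A = family_sum {..<n} V"
    using direct_family_if_direct_sum_of[OF sum] sub by blast+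
  have ViA: "v \<in> A" if "i < n" "v \<in> V i" for i v
    unfolding dir(2) using that sub by (intro family_sum_single) auto
  have scalar: "\<exists>c. \<forall>v\<in>V i. p x v = c *s v" if i: "i < n" for i x
  proof -
    have pV: "p x v \<in> V i" if "v \<in> V i" for v
    proof (rule endo_preserves_summand[OF dir(1) endo(1)])
      show "p x u \<in> family_sum {..<n} V" for u using pA dir(2) by blast
      show "p x (br s u) = br s (p x u)" if "u \<in> family_sum {..<n} V" for s u
        using pbr that dir(2) by blast
    qed (use irr noniso i that in auto)
    obtain c where "\<And>v. v \<in> V i \<Longrightarrow> p x v = c *s v"
      using schur[OF irr[OF i] endo(1) pV pbr] ViA[OF i] by blast
    then show ?thesis by blast
  qed
  have pp: "p x (p y a) = p y (p x a)" if a: "a \<in> A" for x y a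
  proof -
    have *: "p x (p y v) = p y (p x v)" if v: "i < n" "v \<in> V i" for i v
    proof -
      obtain c d where "\<forall>v\<in>V i. p x v = c *s v" "\<forall>v\<in>V i. p y v = d *s v"
        using scalar[OF v(1)] by metis
      then show ?thesis using v(2) by (simp add: endo_scale[OF endo(1)] mult.commute)
    qed
    obtain v where "\<forall>i<n. v i \<in> V i" "a = (\<Sum>i<n. v i)"
      using a sum unfolding direct_sum_of_def by blast
    then show ?thesis using * by (simp add: endo_sum[OF endo(1)])
  qed
  \<comment> \<open>Perfectness in the form used twice below, with \<open>W\<close> the kernel of
    \<open>\<lambda>x. p x y\<close>.\<close>
  have all: "W = UNIV" if "subspace W" "\<And>x y. br x y \<in> W" for W
    using bracket_space_minimal[of UNIV UNIV W] that perfect unfolding perfect_def by blast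
  have ker: "subspace {x. p x y = 0}" for y
    by (rule module_hom.subspace_kernel[OF endo_hom[OF endo(2)]])
  \<comment> \<open>\<open>p (br x y) a\<close> is the commutator of \<open>p x\<close> and
    \<open>p y\<close> at \<open>a\<close>, which is zero by \<open>pp\<close>.\<close>
  have pa: "p x a = 0" if "a \<in> A" for x a
    using all[OF ker[of a]] pp[OF that] by (auto simp: hom)
  \<comment> \<open>All products lie in \<open>A\<close>, where every left multiplication is now
    zero; so both terms of \<open>p (br x y) z\<close> vanish.\<close>
  show ?thesis
    using all[OF ker[of y]] pa[OF pA] by (auto simp: hom)
qed

end

theorem theorem5p19:
  fixes scale :: "complex \<Rightarrow> 'a::ab_group_add \<Rightarrow> 'a"
    and br :: "'a \<Rightarrow> 'a \<Rightarrow> 'a"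
    and A S :: "'a set"
    and p :: "'a \<Rightarrow> 'a \<Rightarrow> 'a"
  assumes "lie_algebra scale br"
    and "\<exists>B. finite_dimensional_vector_space scale B"
    and "lie_algebra.perfect scale br"
    and "lie_algebra.semidirect_product scale br A S"
    and "lie_algebra.semisimple scale br S"
    and "lie_algebra.solvable_radical_of scale br A UNIV"
    and "lie_algebra.abelian br A"
    and "\<exists>n V. lie_algebra.direct_sum_of A n V \<and>
           (\<forall>i<n. lie_algebra.irreducible_module scale br S (V i)) \<and>
           (\<forall>i<n. \<forall>j<n. i \<noteq> j \<longrightarrow>
              \<not> lie_algebra.isomorphic_modules scale br S (V i) (V j))"
    and "lie_algebra.commutative_post_lie scale br p"
  shows "\<forall>x y. p x y = 0"
proof (intro allI)
  fix x y
  obtain B where "finite_dimensional_vector_space scale B" using assms(2) by blast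
  then interpret complex_lie_algebra scale br B
    using assms(1) by (intro complex_lie_algebra.intro complex_fd_space.intro)
  obtain n V where V: "direct_sum_of A n V" "\<And>i. i < n \<Longrightarrow> irreducible_module S (V i)"
    "\<And>i j. i < n \<Longrightarrow> j < n \<Longrightarrow> i \<noteq> j \<Longrightarrow> \<not> isomorphic_modules S (V i) (V j)"
    using assms(8) by blast
  show "p x y = 0"
    by (rule commutative_post_lie_trivial[OF assms(3,6,7) V assms(9)])
qed

end
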